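(* Let $\mathcal{P}=(V;\leq_{\mathcal{P}})$ be a finite poset with $|V|=n$, let $\leq_{\mathcal{Q}}$ be a partial order on $V$ extending $\leq_{\mathcal{P}}$ (i.e. $\leq_{\mathcal{P}}\subseteq\leq_{\mathcal{Q}}$), and let $\omega:V\to\mathbb{R}$ be a weight function that is increasing on $\mathcal{Q}$: $u\leq_{\mathcal{Q}}v\Rightarrow\omega(u)\leq\omega(v)$. Extend $\omega$ additively to subsets, $\omega(S)=\sum_{v\in S}\omega(v)$. Let $\tau:V\to\{1,\dots,n\}$ be a bijection with $u\leq_{\mathcal{Q}}v\Rightarrow\tau(u)\leq\tau(v)$, and let $a\in V$. Define $\varphi_{a,\tau}:\mathcal{I}(\mathcal{P})\to\mathcal{I}(\mathcal{P})$ as follows: for $I\in\mathcal{I}(\mathcal{P})$, let $A_I=\{v\in I: a\leq_{\mathcal{Q}}v\}$ and $B_I=\{u\in V\setminus I: u<_{\mathcal{Q}}a\}$; if both are nonempty, let $v_{\max}$ be the element of $A_I$ with largest $\tau$-value and $v_{\min}$ the element of $B_I$ with smallest $\tau$-value and set $\varphi_{a,\tau}(I)=(I\setminus\{v_{\max}\})\cup\{v_{\min}\}$; otherwise set $\varphi_{a,\tau}(I)=I$. Then $\varphi_{a,\tau}$ is a Steiner operation for the minimum weight ideal problem on $(\mathcal{P};\omega)$, i.e. $\varphi_{a,\tau}$ maps $\mathcal{I}(\mathcal{P})$ into $\mathcal{I}(\mathcal{P})$ and for all $I,J\in\mathcal{I}(\mathcal{P})$: (1) $|\varphi_{a,\tau}(I)|=|I|$;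 (2) $\omega(\varphi_{a,\tau}(I))\leq\omega(I)$; (3) $I\subseteq J\Rightarrow\varphi_{a,\tau}(I)\subseteq\varphi_{a,\tau}(J)$; (4) with $\tau(S)=\sum_{x\in S}\tau(x)$, $\tau(\varphi_{a,\tau}(I))\leq\tau(I)$, with equality if and only if $\varphi_{a,\tau}(I)=I$.
   Context: For a finite poset $\mathcal{P}=(V;\leq)$, a set $I\subseteq V$ is an (order) ideal if $y\in I$ and $x\leq y$ imply $x\in I$; $\mathcal{I}(\mathcal{P})$ denotes the set of all ideals of $\mathcal{P}$. $u<_{\mathcal{Q}}a$ means $u\leq_{\mathcal{Q}}a$ and $u\neq a$. The minimum weight ideal (MWI) problem on $(\mathcal{P};\omega)$ is to minimize $\omega(I)$ over $I\in\mathcal{I}(\mathcal{P})$ with $|I|=k$; a Steiner operation for it is one whose boundary functional is the weight $\omega$. *)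

theory Defs
  imports Complex_Main
begin

definition order_ideals :: "'a set \<Rightarrow> 'a rel \<Rightarrow> 'a set set" where
  "order_ideals V P = {I. I \<subseteq> V \<and> (\<forall>y\<in>I. \<forall>x. (x, y) \<in> P \<longrightarrow> x \<in> I)}"

text \<open>
  A Steiner operation on a family \<open>F\<close> of finite sets, for a boundary functional \<open>d\<close> and a
  numbering \<open>\<tau>\<close> of the ground set. For the minimum weight ideal problem, \<open>F\<close> is the
  family of order ideals and \<open>d\<close> is the additive weight \<open>sum \<omega>\<close>.
\<close>

definition steiner_operation ::
    "'a set set \<Rightarrow> ('a set \<Rightarrow> real) \<Rightarrow> ('a \<Rightarrow> nat) \<Rightarrow> ('a set \<Rightarrow> 'a set) \<Rightarrow> bool" where
  "steiner_operation F d \<tau> \<phi> \<longleftrightarrow>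
     (\<forall>I\<in>F. \<phi> I \<in> F) \<and>
     (\<forall>I\<in>F. card (\<phi> I) = card I) \<and>
     (\<forall>I\<in>F. d (\<phi> I) \<le> d I) \<and>
     (\<forall>I\<in>F. \<forall>J\<in>F. I \<subseteq> J \<longrightarrow> \<phi> I \<subseteq> \<phi> J) \<and>
     (\<forall>I\<in>F. sum \<tau> (\<phi> I) \<le> sum \<tau> I \<and> (sum \<tau> (\<phi> I) = sum \<tau> I \<longleftrightarrow> \<phi> I = I))"

definition mwi_steiner_operation ::
    "'a set \<Rightarrow> 'a rel \<Rightarrow> ('a \<Rightarrow> real) \<Rightarrow> ('a \<Rightarrow> nat) \<Rightarrow> ('a set \<Rightarrow> 'a set) \<Rightarrow> bool" where
  "mwi_steiner_operation V P \<omega> \<tau> \<phi> \<longleftrightarrow> steiner_operation (order_ideals V P) (sum \<omega>) \<tau> \<phi>"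

text \<open>
  When \<open>V\<close> is finite and \<open>\<tau>\<close> is injective on \<open>V\<close>, the extremal elements chosen below are
  uniquely determined.
\<close>

definition ideal_swap ::
    "'a set \<Rightarrow> 'a rel \<Rightarrow> 'a \<Rightarrow> ('a \<Rightarrow> nat) \<Rightarrow> 'a set \<Rightarrow> 'a set" where
  "ideal_swap V Q a \<tau> I =
     (let A = {v \<in> I. (a, v) \<in> Q};
          B = {u \<in> V - I. (u, a) \<in> Q \<and> u \<noteq> a}
      in if A \<noteq> {} \<and> B \<noteq> {}
         then (I - {arg_max_on \<tau> A}) \<union> {arg_min_on \<tau> B}
         else I)"

end

theory Submission
  imports Defs
begin

text \<open>
  Every element of \<open>A\<^sub>I\<close> lies strictly above every element of \<open>B\<^sub>I\<close> in \<open>Q\<close>, with \<open>a\<close> in between,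
  so a swap never raises \<open>\<omega>\<close> and strictly lowers \<open>\<tau>\<close>; extremality of the swapped elements makes the result an
  ideal. Monotonicity holds because \<open>A\<^sub>I\<close> grows and \<open>B\<^sub>I\<close> shrinks with \<open>I\<close>: passing from \<open>I\<close> to a
  larger \<open>J\<close>, the element removed from \<open>J\<close> is either outside \<open>I\<close> or is the one removed from \<open>I\<close>,
  and the element added to \<open>I\<close> is either already in \<open>J\<close> or is the one added to \<open>J\<close>.
\<close>

lemma arg_max_on_nat_finite:
  fixes f :: "'a \<Rightarrow> nat"
  assumes "finite S" and "S \<noteq> {}"
  shows "arg_max_on f S \<in> S" and "\<And>x. x \<in> S \<Longrightarrow> f x \<le> f (arg_max_on f S)"
proof -
  obtain k where k: "k \<in> S" using assms(2) by blast
  \<comment> \<open>The library facts on \<open>arg_max\<close> over the naturals ask for a strict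
    upper bound, hence the \<open>Suc\<close>.\<close>
  have b: "\<forall>y. y \<in> S \<longrightarrow> f y < Suc (Max (f ` S))"
    using assms(1) by (simp add: less_Suc_eq_le)
  show "arg_max_on f S \<in> S"
    unfolding arg_max_on_def using arg_max_natI[of "\<lambda>x. x \<in> S", OF k b] .
  show "f x \<le> f (arg_max_on f S)" if "x \<in> S" for x
    unfolding arg_max_on_def using arg_max_nat_le[of "\<lambda>x. x \<in> S", OF that b] .
qed

lemma arg_min_on_finite:
  fixes f :: "'a \<Rightarrow> 'b::linorder"
  assumes "finite S" and "S \<noteq> {}"
  shows "arg_min_on f S \<in> S" and "\<And>x. x \<in> S \<Longrightarrow> f (arg_min_on f S) \<le> f x"
  using arg_min_if_finite[OF assms, of f] by (auto simp: not_less[symmetric])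

text \<open>Replaces the choice operators by explicit \<open>v\<close> and \<open>u\<close> with
  their extremal properties. The second fact of \<open>fixed\<close> is what monotonicity needs when
  only one of two nested ideals is changed.\<close>

lemma ideal_swap_cases [consumes 2, case_names fixed swap]:
  assumes "finite V" and "I \<subseteq> V"
  obtains (fixed) "ideal_swap V Q a \<tau> I = I"
      "(\<forall>v\<in>I. (a, v) \<notin> Q) \<or> (\<forall>u\<in>V - I. (u, a) \<in> Q \<longrightarrow> u = a)"
  | (swap) v u where "ideal_swap V Q a \<tau> I = insert u (I - {v})"
      "v \<in> I" "(a, v) \<in> Q" "\<And>x. x \<in> I \<Longrightarrow> (a, x) \<in> Q \<Longrightarrow> \<tau> x \<le> \<tau> v"
      "u \<in> V" "u \<notin> I" "(u, a) \<in> Q" "u \<noteq> a"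
      "\<And>x. x \<in> V \<Longrightarrow> x \<notin> I \<Longrightarrow> (x, a) \<in> Q \<Longrightarrow> x \<noteq> a \<Longrightarrow> \<tau> u \<le> \<tau> x"
proof -
  define A where "A = {v \<in> I. (a, v) \<in> Q}"
  define B where "B = {u \<in> V - I. (u, a) \<in> Q \<and> u \<noteq> a}"
  have fin: "finite A" "finite B"
    using assms by (auto simp: A_def B_def intro: rev_finite_subset)
  have eq: "ideal_swap V Q a \<tau> I =
      (if A \<noteq> {} \<and> B \<noteq> {} then insert (arg_min_on \<tau> B) (I - {arg_max_on \<tau> A}) else I)"
    by (simp only: ideal_swap_def A_def B_def Let_def Un_insert_right Un_empty_right)
  show thesis
  proof (cases "A \<noteq> {} \<and> B \<noteq> {}")
    case True
    note max = arg_max_on_nat_finite[OF fin(1), where f = \<tau>]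
      and min = arg_min_on_finite[OF fin(2), where f = \<tau>]
    have "arg_max_on \<tau> A \<in> A" "arg_min_on \<tau> B \<in> B"
      using True max(1) min(1) by auto
    moreover have "\<tau> x \<le> \<tau> (arg_max_on \<tau> A)" if "x \<in> I" "(a, x) \<in> Q" for x
      using True max(2)[of x] that by (auto simp: A_def)
    moreover have "\<tau> (arg_min_on \<tau> B) \<le> \<tau> x"
      if "x \<in> V" "x \<notin> I" "(x, a) \<in> Q" "x \<noteq> a" for x
      using True min(2)[of x] that by (auto simp: B_def)
    moreover have "ideal_swap V Q a \<tau> I = insert (arg_min_on \<tau> B) (I - {arg_max_on \<tau> A})"
      using True eq by simp
    ultimately show thesis
      using swap[of "arg_min_on \<tau> B" "arg_max_on \<tau> A"] unfolding A_def B_def by blast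
  next
    case False
    then have "ideal_swap V Q a \<tau> I = I" using eq by auto
    moreover have "(\<forall>v\<in>I. (a, v) \<notin> Q) \<or> (\<forall>u\<in>V - I. (u, a) \<in> Q \<longrightarrow> u = a)"
      using False unfolding A_def B_def by blast
    ultimately show thesis by (rule fixed)
  qed
qed

theorem theorem4:
  fixes V :: "'a set" and n :: nat and P Q :: "'a rel"
    and \<omega> :: "'a \<Rightarrow> real" and \<tau> :: "'a \<Rightarrow> nat" and a :: 'a
  assumes "finite V" and "card V = n"
    and "partial_order_on V P"
    and "partial_order_on V Q"
    and "P \<subseteq> Q"
    and "\<And>u v. (u, v) \<in> Q \<Longrightarrow> \<omega> u \<le> \<omega> v"
    and "bij_betw \<tau> V {1..n}"
    and "\<And>u v. (u, v) \<in> Q \<Longrightarrow> \<tau> u \<le> \<tau> v"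
    and "a \<in> V"
  shows "mwi_steiner_operation V P \<omega> \<tau> (ideal_swap V Q a \<tau>)"
proof -
  let ?\<phi> = "ideal_swap V Q a \<tau>"
  have transQ: "(x, z) \<in> Q" if "(x, y) \<in> Q" "(y, z) \<in> Q" for x y z
    using assms(4) that by (auto simp: partial_order_on_def preorder_on_def dest: transD)
  have antisymQ: "x = y" if "(x, y) \<in> Q" "(y, x) \<in> Q" for x y
    using assms(4) that by (auto simp: partial_order_on_def dest: antisymD)
  have PV: "x \<in> V" "y \<in> V" if "(x, y) \<in> P" for x y
    using assms(3) that by (auto simp: partial_order_on_def preorder_on_def)
  have injV: "x = y" if "\<tau> x = \<tau> y" "x \<in> V" "y \<in> V" for x y
    using assms(7) that by (auto simp: bij_betw_def dest: inj_onD)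

  have ideal: "?\<phi> I \<in> order_ideals V P" if I: "I \<in> order_ideals V P" for I
  proof -
    have IV: "I \<subseteq> V" and down: "\<And>x y. y \<in> I \<Longrightarrow> (x, y) \<in> P \<Longrightarrow> x \<in> I"
      using I by (auto simp: order_ideals_def)
    from assms(1) IV show ?thesis
    proof (cases rule: ideal_swap_cases[where Q = Q and a = a and \<tau> = \<tau>])
      case fixed
      then show ?thesis using I by simp
    next
      case (swap v u)
      have "x \<in> insert u (I - {v})" if y: "y \<in> insert u (I - {v})" and xy: "(x, y) \<in> P" for x y
      proof (cases "y = u")
        case True
        \<comment> \<open>Here \<open>x\<close> lies strictly below \<open>a\<close>. If it were
          missing from \<open>I\<close>, it would compete with \<open>u\<close> for the minimum, so
          \<open>\<tau> u \<le> \<tau> x \<le> \<tau> u\<close> and \<open>x = u\<close>.\<close>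
        have xu: "(x, u) \<in> Q" using xy True assms(5) by auto
        then have xa: "(x, a) \<in> Q" using transQ swap(7) by blast
        have "x \<noteq> a" using xu swap(7,8) antisymQ by blast
        then have "x \<noteq> v" using xa swap(3) antisymQ by blast
        moreover have "x = u" if "x \<notin> I"
          using injV[OF order_antisym, OF assms(8)[OF xu] swap(9)] that xa \<open>x \<noteq> a\<close>
            PV(1)[OF xy] swap(5) by simp
        ultimately show ?thesis by blast
      next
        case False
        then have yI: "y \<in> I" "y \<noteq> v" using y by auto
        \<comment> \<open>An element \<open>y\<close> of \<open>I\<close> above \<open>v\<close> is
          also above \<open>a\<close>, so maximality of \<open>\<tau> v\<close> forces a tie and
          hence \<open>y = v\<close>.\<close>
        have "x \<noteq> v"
        proof
          assume "x = v"
          then have vy: "(v, y) \<in> Q" using xy assms(5) by auto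
          have "\<tau> y = \<tau> v"
            using swap(4)[OF yI(1) transQ[OF swap(3) vy]] assms(8)[OF vy] by simp
          then show False using injV yI IV swap(2) by blast
        qed
        then show ?thesis using down[OF yI(1) xy] by simp
      qed
      then show ?thesis
        unfolding swap(1) order_ideals_def using IV swap(5) by blast
    qed
  qed

  have mono: "?\<phi> I \<subseteq> ?\<phi> J"
    if "I \<in> order_ideals V P" "J \<in> order_ideals V P" and IJ: "I \<subseteq> J" for I J
  proof -
    have IV: "I \<subseteq> V" and JV: "J \<subseteq> V" using that by (auto simp: order_ideals_def)
    from assms(1) IV show ?thesis
    proof (cases rule: ideal_swap_cases[where Q = Q and a = a and \<tau> = \<tau>])
      case I: fixed
      from assms(1) JV show ?thesis
      proof (cases rule: ideal_swap_cases[where Q = Q and a = a and \<tau> = \<tau>])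
        case J: fixed
        then show ?thesis using I IJ by simp
      next
        case J: (swap v u)
        \<comment> \<open>The element added to \<open>J\<close> is outside \<open>I\<close> and
          strictly below \<open>a\<close>, so \<open>I\<close> can only be fixed by having nothing
          above \<open>a\<close>.\<close>
        then have "v \<notin> I" using I(2) IJ by blast
        then show ?thesis using I(1) J(1) IJ by blast
      qed
    next
      case I: (swap v u)
      from assms(1) JV show ?thesis
      proof (cases rule: ideal_swap_cases[where Q = Q and a = a and \<tau> = \<tau>])
        case J: fixed
        \<comment> \<open>Since \<open>v\<close> lies in \<open>J\<close> and above
          \<open>a\<close>, \<open>J\<close> is fixed only because it contains everything strictly
          below \<open>a\<close>.\<close>
        then have "u \<in> J" using I IJ by blast
        then show ?thesis using I(1) J(1) IJ by auto
      next
        case J: (swap v' u')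
        \<comment> \<open>Both \<open>v\<close> and \<open>v'\<close> are then candidates in both
          maximizations, so their \<open>\<tau>\<close>-values tie. The next claim is dual.\<close>
        have "v' = v" if "v' \<in> I"
          using injV[OF order_antisym, OF I(4)[OF that J(3)] J(4)[OF _ I(3)]] I(2) J(2) IJ JV
          by blast
        moreover have "u = u'" if "u \<notin> J"
          using injV[OF order_antisym, OF I(9)[OF J(5) _ J(7,8)] J(9)[OF I(5) that I(7,8)]]
            I(5) J(5,6) IJ by blast
        \<comment> \<open>This ensures that the element added to \<open>I\<close> is not the one
          removed from \<open>J\<close>.\<close>
        moreover have "u \<noteq> v'" using I(7,8) J(3) antisymQ by blast
        ultimately show ?thesis unfolding I(1) J(1) using IJ by auto
      qed
    qed
  qed

  have sums: "card (?\<phi> I) = card I \<and> sum \<omega> (?\<phi> I) \<le> sum \<omega> I \<and>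
      sum \<tau> (?\<phi> I) \<le> sum \<tau> I \<and> (sum \<tau> (?\<phi> I) = sum \<tau> I \<longleftrightarrow> ?\<phi> I = I)"
    if "I \<in> order_ideals V P" for I
  proof -
    have IV: "I \<subseteq> V" using that by (auto simp: order_ideals_def)
    then have fin: "finite I" using assms(1) finite_subset by blast
    from assms(1) IV show ?thesis
    proof (cases rule: ideal_swap_cases[where Q = Q and a = a and \<tau> = \<tau>])
      case fixed
      then show ?thesis by simp
    next
      case (swap v u)
      have uv: "(u, v) \<in> Q" using transQ swap(3,7) by blast
      \<comment> \<open>Only \<open>v\<close> lies in \<open>I\<close>, so \<open>u\<close> and
        \<open>v\<close> differ. The resulting strict drop rules out equal
        \<open>\<tau>\<close>-sums after a genuine swap.\<close>
      have "\<tau> u \<noteq> \<tau> v" using injV swap(2,5,6) IV by blast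
      then have less: "\<tau> u < \<tau> v" using assms(8)[OF uv] by simp
      have "sum \<tau> (?\<phi> I) = \<tau> u + sum \<tau> (I - {v})" "sum \<tau> I = \<tau> v + sum \<tau> (I - {v})"
        using swap(1,2,6) fin sum.remove[of I v \<tau>] by simp_all
      then have "sum \<tau> (?\<phi> I) < sum \<tau> I" using less by simp
      moreover have "sum \<omega> (?\<phi> I) \<le> sum \<omega> I"
        using swap(1,2,6) fin assms(6)[OF uv] by (simp add: sum_diff1)
      moreover have "card (?\<phi> I) = card I"
        using swap(1,2,6) fin card.remove[of I v] by simp
      ultimately show ?thesis by auto
    qed
  qed

  show ?thesis
    unfolding mwi_steiner_operation_def steiner_operation_def
    using ideal mono sums by blast
qed

end
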